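(* Let $U,V\subseteq\mathbb{R}^n$ be linear subspaces with $V\not\subset U$, $a=\sin^2\theta_F$, $b=\sin^2\theta_p$, and $$\rho_V=\frac{b-a}{b+a},\qquad \rho_{\mathrm{Cheb}}=\frac{\sqrt b-\sqrt a}{\sqrt b+\sqrt a}.$$ Whenever $\theta_F<\theta_p$ (equivalently $a<b$), $$\rho_{\mathrm{Cheb}}<\rho_V,$$ with explicit ratio $$\frac{\rho_V}{\rho_{\mathrm{Cheb}}}=\frac{(\sqrt a+\sqrt b)^2}{a+b}=1+\frac{2\sqrt{ab}}{a+b}\in(1,2],$$ the ratio attaining the upper limit $2$ as $a/b\to1^-$ (where both rates tend to $0$). Equivalently, for every $w_0\in V\cap(U\cap V)^\perp$ the Chebyshev iterates $w_k$ defined by the three-term recursion in the context satisfy $$\|w_k\|\le 2\rho_{\mathrm{Cheb}}^k\|w_0\|\quad\text{with}\quad \rho_{\mathrm{Cheb}}\le\rho_V\Bigl(1+\frac{2\sqrt{ab}}{a+b}\Bigr)^{-1}.$$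
   Context: For a linear subspace $W\subseteq\mathbb{R}^n$, $P_W$ is the orthogonal projection onto $W$. $p=\dim V$, $s=\dim(U\cap V)<p$. Principal angles: let $\sigma_1\ge\dots\ge\sigma_p\ge0$ be the singular values of $P_U|_V:V\to\mathbb{R}^n$ and $\theta_k=\arccos\sigma_k$, so $0\le\theta_1\le\dots\le\theta_p\le\pi/2$; the first $s$ are $0$. The Friedrichs angle is $\theta_F:=\theta_{s+1}\in(0,\pi/2]$. $M:=(\mathrm{Id}-P_VP_U)|_V:V\to V$. Chebyshev semi-iteration (for $a<b$): with $d=(a+b)/2$ and $r=(a+b)/(b-a)$, given $w_0\in V\cap(U\cap V)^\perp$ set $$w_1=w_0-d^{-1}Mw_0,\qquad w_{k+1}=\omega_{k+1}\bigl(w_k-d^{-1}Mw_k\bigr)+(1-\omega_{k+1})w_{k-1}\quad(k\ge1),$$ where $\omega_2=2r^2/(2r^2-1)$ and $\omega_{k+1}=4r^2/(4r^2-\omega_k)$ for $k\ge2$. *)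

theory Defs
  imports "HOL-Analysis.Analysis"
begin

definition orth_proj :: "'a::euclidean_space set \<Rightarrow> 'a \<Rightarrow> 'a" where
  "orth_proj W x = (THE y. y \<in> W \<and> x - y \<in> W\<^sup>\<bottom>)"

text \<open>
  The adjoint of the restriction of \<open>A\<close> to the subspace \<open>V\<close>, regarded as a map from the inner
  product space \<open>V\<close> to the ambient space; its values lie in \<open>V\<close>.
\<close>

definition adjoint_on ::
    "'a::euclidean_space set \<Rightarrow> ('a \<Rightarrow> 'b::euclidean_space) \<Rightarrow> 'b \<Rightarrow> 'a" where
  "adjoint_on V A y = (THE v. v \<in> V \<and> (\<forall>x\<in>V. A x \<bullet> y = x \<bullet> v))"

text \<open>
  Singular values of the restriction of \<open>A\<close> to \<open>V\<close>: the numbers \<open>t \<ge> 0\<close> such that \<open>t\<^sup>2\<close> is an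
  eigenvalue of the composite of that restriction with its adjoint, a self-map of \<open>V\<close>. They are
  listed in decreasing order, each repeated as often as the dimension of its eigenspace, so that
  there are \<open>dim V\<close> of them (zeros included). The list is indexed from 0.
\<close>

definition singular_mult ::
    "'a::euclidean_space set \<Rightarrow> ('a \<Rightarrow> 'b::euclidean_space) \<Rightarrow> real \<Rightarrow> nat" where
  "singular_mult V A t = dim {v \<in> V. adjoint_on V A (A v) = t\<^sup>2 *\<^sub>R v}"

definition singular_values ::
    "'a::euclidean_space set \<Rightarrow> ('a \<Rightarrow> 'b::euclidean_space) \<Rightarrow> real list" where
  "singular_values V A =
     concat (map (\<lambda>t. replicate (singular_mult V A t) t)
       (rev (sorted_list_of_set {t. 0 \<le> t \<and> 0 < singular_mult V A t})))"

text \<open>Principal angles are numbered from 1 to \<open>dim V\<close>, in increasing order.\<close>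

definition principal_angle :: "'a::euclidean_space set \<Rightarrow> 'a set \<Rightarrow> nat \<Rightarrow> real" where
  "principal_angle U V k = arccos (singular_values V (orth_proj U) ! (k - 1))"

definition friedrichs_angle :: "'a::euclidean_space set \<Rightarrow> 'a set \<Rightarrow> real" where
  "friedrichs_angle U V = principal_angle U V (dim (U \<inter> V) + 1)"

definition rho_V :: "real \<Rightarrow> real \<Rightarrow> real" where
  "rho_V a b = (b - a) / (b + a)"

definition rho_Cheb :: "real \<Rightarrow> real \<Rightarrow> real" where
  "rho_Cheb a b = (sqrt b - sqrt a) / (sqrt b + sqrt a)"

text \<open>Only its values on \<open>V\<close> matter, where it is the self-map \<open>Id - P\<^sub>V P\<^sub>U\<close> of \<open>V\<close>.\<close>

definition M_op :: "'a::euclidean_space set \<Rightarrow> 'a set \<Rightarrow> 'a \<Rightarrow> 'a" where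
  "M_op U V v = v - orth_proj V (orth_proj U v)"

text \<open>The values at 0 and 1 are placeholders; the iteration uses the weights from index 2 on.\<close>

fun cheb_omega :: "real \<Rightarrow> nat \<Rightarrow> real" where
  "cheb_omega r 0 = 1"
| "cheb_omega r (Suc 0) = 1"
| "cheb_omega r (Suc (Suc 0)) = 2 * r\<^sup>2 / (2 * r\<^sup>2 - 1)"
| "cheb_omega r (Suc (Suc (Suc k))) = 4 * r\<^sup>2 / (4 * r\<^sup>2 - cheb_omega r (Suc (Suc k)))"

fun cheb_iter ::
    "('a::real_vector \<Rightarrow> 'a) \<Rightarrow> real \<Rightarrow> real \<Rightarrow> 'a \<Rightarrow> nat \<Rightarrow> 'a" where
  "cheb_iter M a b w0 0 = w0"
| "cheb_iter M a b w0 (Suc 0) =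
     (let d = (a + b) / 2 in w0 - inverse d *\<^sub>R M w0)"
| "cheb_iter M a b w0 (Suc (Suc k)) =
     (let d = (a + b) / 2;
          r = (a + b) / (b - a);
          \<omega> = cheb_omega r (Suc (Suc k));
          w = cheb_iter M a b w0 (Suc k)
      in \<omega> *\<^sub>R (w - inverse d *\<^sub>R M w) + (1 - \<omega>) *\<^sub>R cheb_iter M a b w0 k)"

text \<open>
  The filter on pairs \<open>(a, b)\<close> with \<open>0 < a < b\<close> that expresses that \<open>a / b\<close> tends to 1 from below,
  while \<open>a\<close> and \<open>b\<close> may both vary.
\<close>

definition ratio_to_one :: "(real \<times> real) filter" where
  "ratio_to_one =
     inf (filtercomap (\<lambda>(a, b). a / b) (at_left 1)) (principal {(a, b). 0 < a \<and> a < b})"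

end

theory Submission
  imports Defs
begin

text \<open>
  The operator \<open>P\<^sub>V P\<^sub>U\<close> is self-adjoint on \<open>V\<close>, so \<open>V\<close> has an orthonormal basis of its eigenvectors
  (\<open>self_adjoint_orthonormal_eigenbasis\<close>), and its eigenvalues are the squared cosines of the
  principal angles. The eigenspace for 1 is \<open>U \<inter> V\<close>. Hence \<open>M = Id - P\<^sub>V P\<^sub>U\<close> has its spectrum
  in \<open>[a, b]\<close> on the part of \<open>V\<close> orthogonal to \<open>U \<inter> V\<close>, where \<open>0 < a\<close>
  (\<open>principal_angles_eigenbasis\<close>).

  On an eigenvector of \<open>M\<close> with eigenvalue \<open>\<mu>\<close> the \<open>k\<close>-th iterate multiplies the starting
  coordinate by \<open>T\<^sub>k(x) / T\<^sub>k(r)\<close>, where \<open>T\<^sub>k\<close> is the Chebyshev polynomial,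
  \<open>x = (a + b - 2 \<mu>) / (b - a)\<close> and \<open>r = (a + b) / (b - a)\<close> (\<open>cheb_iter_eigencomponent\<close>). For
  \<open>\<mu>\<close> in \<open>[a, b]\<close> the numerator is at most 1 in absolute value, as \<open>x\<close> is a cosine. The
  denominator is evaluated through \<open>r = (q + 1/q) / 2\<close>, which holds for \<open>q = rho_Cheb a b\<close>, so
  that \<open>T\<^sub>k(r) = (q\<^sup>k + q\<^sup>-\<^sup>k) / 2\<close> and the quotient is at most \<open>2 q\<^sup>k\<close>
  (\<open>inverse_cheb_T_le\<close>). Summing over the eigenbasis gives the norm bound
  (\<open>cheb_iter_norm_le\<close>).

  The comparison of the two rates is algebra in \<open>sqrt a\<close> and \<open>sqrt b\<close>, with the inequality of
  arithmetic and geometric means for the upper bound 2. The limits follow because both rates depend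
  only on \<open>a / b\<close> (\<open>tendsto_ratio_to_one\<close>).
\<close>

section \<open>Diagonalising a self-adjoint map of a subspace\<close>

text \<open>
  A maximiser \<open>e\<close> of the quadratic form \<open>f x \<bullet> x\<close> on the unit sphere of \<open>V\<close>, with maximum \<open>\<mu>\<close>, is
  an eigenvector: the form \<open>\<mu> (x \<bullet> x) - f x \<bullet> x\<close> is nonnegative on \<open>V\<close> and vanishes at \<open>e\<close>, so it
  has no first-order term at \<open>e\<close> in any direction, in particular in the direction \<open>\<mu> e - f e\<close>,
  where that term is twice the squared length of this vector.
\<close>

lemma self_adjoint_eigenvector:
  fixes f :: "'a::euclidean_space \<Rightarrow> 'a"
  assumes f: "linear f" and V: "subspace V" "V \<noteq> {0}"
    and fV: "\<And>x. x \<in> V \<Longrightarrow> f x \<in> V"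
    and sym: "\<And>x y. x \<in> V \<Longrightarrow> y \<in> V \<Longrightarrow> f x \<bullet> y = x \<bullet> f y"
  obtains e c where "e \<in> V" "norm e = 1" "f e = c *\<^sub>R e"
proof -
  define K where "K = V \<inter> sphere 0 1"
  obtain v where v: "v \<in> V" "v \<noteq> 0"
    using V subspace_0[OF V(1)] by blast
  have "inverse (norm v) *\<^sub>R v \<in> K"
    using v V by (simp add: K_def subspace_scale)
  then have "K \<noteq> {}" by blast
  moreover have "compact K"
    unfolding K_def using V by (intro closed_Int_compact closed_subspace compact_sphere)
  moreover have "continuous_on K (\<lambda>x. f x \<bullet> x)"
    by (intro continuous_on_inner continuous_on_id linear_continuous_on)
      (use f in \<open>simp add: linear_conv_bounded_linear\<close>)
  ultimately obtain e where e: "e \<in> K" and max: "\<And>x. x \<in> K \<Longrightarrow> f x \<bullet> x \<le> f e \<bullet> e"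
    using continuous_attains_sup[of K "\<lambda>x. f x \<bullet> x"] by blast
  define \<mu> where "\<mu> = f e \<bullet> e"
  define y where "y = \<mu> *\<^sub>R e - f e"
  have eV: "e \<in> V" and ee: "e \<bullet> e = 1"
    using e by (auto simp: K_def norm_eq_sqrt_inner)
  have yV: "y \<in> V"
    unfolding y_def using eV V fV by (simp add: subspace_diff subspace_scale)
  have psd: "0 \<le> \<mu> * (x \<bullet> x) - f x \<bullet> x" if "x \<in> V" for x
  proof (cases "x = 0")
    case False
    then have "inverse (norm x) *\<^sub>R x \<in> K"
      using that V by (simp add: K_def subspace_scale)
    from max[OF this] have "(inverse (norm x))\<^sup>2 * (f x \<bullet> x) \<le> \<mu>"
      by (simp add: \<mu>_def linear_scale[OF f] power2_eq_square)
    then have "(f x \<bullet> x) / (norm x)\<^sup>2 \<le> \<mu>"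
      by (simp add: field_simps)
    then show ?thesis
      using False by (simp add: divide_le_eq dot_square_norm)
  qed (simp add: linear_0[OF f])
  define c where "c = \<mu> * (y \<bullet> y) - f y \<bullet> y"
  have c: "0 \<le> c" unfolding c_def by (rule psd[OF yV])
  have quad: "0 \<le> 2 * t * (y \<bullet> y) + t\<^sup>2 * c" for t
  proof -
    have "e + t *\<^sub>R y \<in> V"
      using eV yV V by (simp add: subspace_add subspace_scale)
    from psd[OF this] have
      "0 \<le> \<mu> * ((e + t *\<^sub>R y) \<bullet> (e + t *\<^sub>R y)) - (f e + t *\<^sub>R f y) \<bullet> (e + t *\<^sub>R y)"
      by (simp add: linear_add[OF f] linear_scale[OF f])
    also have "\<dots> = 2 * t * (\<mu> * (e \<bullet> y) - f e \<bullet> y) + t\<^sup>2 * c"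
      using sym[OF yV eV] ee
      by (simp add: c_def \<mu>_def inner_simps inner_commute power2_eq_square algebra_simps)
    also have "\<mu> * (e \<bullet> y) - f e \<bullet> y = y \<bullet> y"
      by (metis inner_diff_left inner_scaleR_left y_def)
    finally show ?thesis .
  qed
  \<comment> \<open>A nonnegative quadratic in \<open>t\<close> without constant term has no linear term. Since \<open>c\<close> may vanish,
      it is evaluated at \<open>- (y \<bullet> y) / (c + 1)\<close> rather than at its minimiser.\<close>
  have "y \<bullet> y = 0"
  proof (rule ccontr)
    assume n: "y \<bullet> y \<noteq> 0"
    define t where "t = (y \<bullet> y) / (c + 1)"
    have yy: "y \<bullet> y = t * (c + 1)" and "t \<noteq> 0"
      using c n by (simp_all add: t_def)
    have "0 \<le> - (t\<^sup>2 * (c + 2))"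
      using quad[of "- t"] unfolding yy by (simp add: algebra_simps power2_eq_square)
    moreover have "0 < t\<^sup>2 * (c + 2)"
      using c \<open>t \<noteq> 0\<close> by simp
    ultimately show False by simp
  qed
  then have "f e = \<mu> *\<^sub>R e" by (simp add: y_def)
  with eV ee show ?thesis by (intro that[of e \<mu>]) (auto simp: norm_eq_sqrt_inner)
qed

text \<open>
  The vectors of \<open>V\<close> orthogonal to an eigenvector form a smaller subspace that \<open>f\<close> preserves,
  which allows induction on the dimension.
\<close>

lemma self_adjoint_orthonormal_eigenbasis:
  fixes f :: "'a::euclidean_space \<Rightarrow> 'a"
  assumes f: "linear f" and V: "subspace V"
    and fV: "\<And>x. x \<in> V \<Longrightarrow> f x \<in> V"
    and sym: "\<And>x y. x \<in> V \<Longrightarrow> y \<in> V \<Longrightarrow> f x \<bullet> y = x \<bullet> f y"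
  shows "\<exists>B. pairwise orthogonal B \<and> (\<forall>e\<in>B. norm e = 1 \<and> (\<exists>c. f e = c *\<^sub>R e)) \<and> span B = V"
  using V fV sym
proof (induction "dim V" arbitrary: V rule: less_induct)
  case less
  show ?case
  proof (cases "V = {0}")
    case True
    then show ?thesis by (intro exI[of _ "{}"]) auto
  next
    case False
    obtain e c where e: "e \<in> V" "norm e = 1" "f e = c *\<^sub>R e"
      using self_adjoint_eigenvector[OF f less.prems(1) False less.prems(2,3)] by blast
    define W where "W = V \<inter> {x. orthogonal e x}"
    have W: "subspace W"
      unfolding W_def by (intro subspace_inter less.prems subspace_orthogonal_to_vector)
    have "e \<notin> W"
      using e by (auto simp: W_def orthogonal_def norm_eq_sqrt_inner)
    then have "W \<subset> V"
      using e(1) by (auto simp: W_def)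
    then have dim: "dim W < dim V"
      using W less.prems(1) by (intro dim_psubset) (auto simp: span_eq_iff[THEN iffD2])
    have inv: "f x \<in> W" if "x \<in> W" for x
      using that less.prems(2)[of x] less.prems(3)[of e x] e
      by (auto simp: W_def orthogonal_def)
    have symW: "f x \<bullet> y = x \<bullet> f y" if "x \<in> W" "y \<in> W" for x y
      using that less.prems(3)[of x y] by (auto simp: W_def)
    obtain B where B: "pairwise orthogonal B" "span B = W"
      "\<And>b. b \<in> B \<Longrightarrow> norm b = 1 \<and> (\<exists>c. f b = c *\<^sub>R b)"
      using less.hyps[OF dim W inv symW] by blast
    have BW: "B \<subseteq> W" using B(2) span_superset by blast
    have "span (insert e B) = V"
    proof
      show "span (insert e B) \<subseteq> V"
        using e BW less.prems(1) by (intro span_minimal) (auto simp: W_def)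
      show "V \<subseteq> span (insert e B)"
      proof
        fix x assume x: "x \<in> V"
        have "x - (x \<bullet> e) *\<^sub>R e \<in> W"
          using x e less.prems(1)
          by (auto simp: W_def orthogonal_def subspace_diff subspace_scale inner_simps
              inner_commute norm_eq_sqrt_inner)
        then show "x \<in> span (insert e B)"
          using B(2) span_breakdown_eq by blast
      qed
    qed
    moreover have "pairwise orthogonal (insert e B)"
      using B(1) BW by (auto simp: pairwise_insert W_def orthogonal_commute)
    ultimately show ?thesis
      using B(3) e by (intro exI[of _ "insert e B"]) auto
  qed
qed

lemma norm_orthonormal_expansion:
  fixes B :: "'a::euclidean_space set"
  assumes "pairwise orthogonal B" "\<And>e. e \<in> B \<Longrightarrow> norm e = 1" "x \<in> span B"
  shows "(norm x)\<^sup>2 = (\<Sum>e\<in>B. (x \<bullet> e)\<^sup>2)"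
proof -
  have fin: "finite B" using pairwise_orthogonal_imp_finite[OF assms(1)] .
  have "(norm x)\<^sup>2 = (norm (\<Sum>e\<in>B. (x \<bullet> e) *\<^sub>R e))\<^sup>2"
    using orthonormal_basis_expand[OF assms fin] by simp
  also have "\<dots> = (\<Sum>e\<in>B. (norm ((x \<bullet> e) *\<^sub>R e))\<^sup>2)"
    using assms(1) by (intro norm_sum_Pythagorean fin)
      (auto simp: pairwise_def orthogonal_clauses)
  also have "\<dots> = (\<Sum>e\<in>B. (x \<bullet> e)\<^sup>2)"
    by (intro sum.cong) (auto simp: assms(2) power_mult_distrib)
  finally show ?thesis .
qed

text \<open>This turns the multiplicity of an eigenvalue into the number of basis vectors that carry it.\<close>

lemma eigenspace_eq_span:
  fixes f :: "'a::euclidean_space \<Rightarrow> 'a"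
  assumes f: "linear f"
    and B: "pairwise orthogonal B" "\<And>e. e \<in> B \<Longrightarrow> norm e = 1"
    and eig: "\<And>e. e \<in> B \<Longrightarrow> f e = l e *\<^sub>R e"
  shows "{v \<in> span B. f v = c *\<^sub>R v} = span {e \<in> B. l e = c}"
proof
  have fin: "finite B" using pairwise_orthogonal_imp_finite[OF B(1)] .
  have ind: "independent B"
    using B(1)
  proof (rule pairwise_orthogonal_independent)
    show "0 \<notin> B" using B(2) by fastforce
  qed
  show "span {e \<in> B. l e = c} \<subseteq> {v \<in> span B. f v = c *\<^sub>R v}"
  proof (rule span_minimal)
    show "{e \<in> B. l e = c} \<subseteq> {v \<in> span B. f v = c *\<^sub>R v}"
      by (auto simp: eig span_base)
    show "subspace {v \<in> span B. f v = c *\<^sub>R v}"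
      by (auto simp: subspace_def span_zero span_add span_scale linear_0[OF f] linear_add[OF f]
          linear_scale[OF f] scaleR_add_right)
  qed
  show "{v \<in> span B. f v = c *\<^sub>R v} \<subseteq> span {e \<in> B. l e = c}"
  proof clarify
    fix v assume v: "v \<in> span B" "f v = c *\<^sub>R v"
    have ex: "(\<Sum>e\<in>B. (v \<bullet> e) *\<^sub>R e) = v"
      by (rule orthonormal_basis_expand[OF B v(1) fin])
    have "(\<Sum>e\<in>B. ((l e - c) * (v \<bullet> e)) *\<^sub>R e)
        = f (\<Sum>e\<in>B. (v \<bullet> e) *\<^sub>R e) - c *\<^sub>R (\<Sum>e\<in>B. (v \<bullet> e) *\<^sub>R e)"
      by (simp add: linear_sum[OF f] linear_scale[OF f] eig scaleR_sum_right
          sum_subtractf[symmetric] algebra_simps)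
    also have "\<dots> = 0" by (simp add: ex v)
    finally have zero: "(l e - c) * (v \<bullet> e) = 0" if "e \<in> B" for e
      using independentD[OF ind fin subset_refl _ that, where u = "\<lambda>e. (l e - c) * (v \<bullet> e)"] by simp
    have "(\<Sum>e\<in>B. (v \<bullet> e) *\<^sub>R e) \<in> span {e \<in> B. l e = c}"
    proof (rule span_sum)
      fix e assume e: "e \<in> B"
      show "(v \<bullet> e) *\<^sub>R e \<in> span {e \<in> B. l e = c}"
        using zero[OF e] e by (cases "l e = c") (auto intro: span_scale span_base span_zero)
    qed
    then show "v \<in> span {e \<in> B. l e = c}" by (simp add: ex)
  qed
qed

section \<open>Orthogonal projections\<close>

lemma orth_proj_eqI:
  fixes W :: "'a::euclidean_space set"
  assumes "subspace W" "y \<in> W" "x - y \<in> W\<^sup>\<bottom>"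
  shows "orth_proj W x = y"
  unfolding orth_proj_def
proof (rule the_equality)
  fix z assume z: "z \<in> W \<and> x - z \<in> W\<^sup>\<bottom>"
  have "y - z \<in> W" using assms z by (simp add: subspace_diff)
  then have "(y - z) \<bullet> (x - z) = 0" "(y - z) \<bullet> (x - y) = 0"
    using assms z by (auto simp: orthogonal_comp_def orthogonal_def)
  then have "(y - z) \<bullet> (y - z) = 0"
    by (simp add: inner_simps)
  then show "z = y" by simp
qed (use assms in auto)

lemma
  fixes W :: "'a::euclidean_space set"
  assumes W: "subspace W"
  shows orth_proj_in: "orth_proj W x \<in> W"
    and orth_proj_residual: "x - orth_proj W x \<in> W\<^sup>\<bottom>"
proof -
  obtain y z where yz: "y \<in> span W" "\<And>w. w \<in> span W \<Longrightarrow> orthogonal z w" "x = y + z"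
    using orthogonal_subspace_decomp_exists by metis
  have "y \<in> W" "x - y \<in> W\<^sup>\<bottom>"
    using yz W by (auto simp: orthogonal_comp_def orthogonal_commute span_eq_iff[THEN iffD2])
  with orth_proj_eqI[OF W this] show "orth_proj W x \<in> W" "x - orth_proj W x \<in> W\<^sup>\<bottom>" by auto
qed

lemma orth_proj_inner:
  fixes W :: "'a::euclidean_space set"
  assumes "subspace W" "w \<in> W"
  shows "orth_proj W x \<bullet> w = x \<bullet> w"
  using orth_proj_residual[OF assms(1), of x] assms(2)
  by (auto simp: orthogonal_comp_def orthogonal_def inner_simps inner_commute)

lemma orth_proj_self:
  fixes W :: "'a::euclidean_space set"
  assumes "subspace W" "x \<in> W"
  shows "orth_proj W x = x"
  using assms by (intro orth_proj_eqI) (auto simp: subspace_orthogonal_comp subspace_0)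

lemma linear_orth_proj:
  fixes W :: "'a::euclidean_space set"
  assumes "subspace W"
  shows "linear (orth_proj W)"
proof (rule linearI)
  fix x y :: 'a and c :: real
  show "orth_proj W (x + y) = orth_proj W x + orth_proj W y"
    using assms orth_proj_in[OF assms] subspace_add[OF subspace_orthogonal_comp
        orth_proj_residual[OF assms, of x] orth_proj_residual[OF assms, of y]]
    by (intro orth_proj_eqI) (auto simp: subspace_add algebra_simps)
  show "orth_proj W (c *\<^sub>R x) = c *\<^sub>R orth_proj W x"
    using assms orth_proj_in[OF assms]
      subspace_scale[OF subspace_orthogonal_comp orth_proj_residual[OF assms, of x], of c]
    by (intro orth_proj_eqI) (auto simp: subspace_scale scaleR_diff_right)
qed

lemma orth_proj_sym:
  fixes W :: "'a::euclidean_space set"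
  assumes "subspace W"
  shows "orth_proj W x \<bullet> y = orth_proj W x \<bullet> orth_proj W y"
  using orth_proj_inner[OF assms orth_proj_in[OF assms], of y x] by (simp add: inner_commute)

lemma
  fixes W :: "'a::euclidean_space set"
  assumes W: "subspace W"
  shows orth_proj_norm_le: "orth_proj W x \<bullet> orth_proj W x \<le> x \<bullet> x"
    and orth_proj_norm_eq_iff: "orth_proj W x \<bullet> orth_proj W x = x \<bullet> x \<longleftrightarrow> x \<in> W"
proof -
  have "(x - orth_proj W x) \<bullet> (x - orth_proj W x) = x \<bullet> x - orth_proj W x \<bullet> orth_proj W x"
    using orth_proj_sym[OF W, of x x] by (simp add: inner_simps inner_commute)
  moreover from this have "orth_proj W x \<bullet> orth_proj W x = x \<bullet> x \<Longrightarrow> x = orth_proj W x"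
    by simp
  moreover have "x \<in> W \<Longrightarrow> orth_proj W x = x"
    using W by (rule orth_proj_self)
  ultimately show "orth_proj W x \<bullet> orth_proj W x \<le> x \<bullet> x"
    "orth_proj W x \<bullet> orth_proj W x = x \<bullet> x \<longleftrightarrow> x \<in> W"
    using inner_ge_zero[of "x - orth_proj W x"] orth_proj_in[OF W, of x] by auto
qed

lemma orth_proj_twice_inner:
  fixes U V :: "'a::euclidean_space set"
  assumes "subspace U" "subspace V" "y \<in> V"
  shows "orth_proj V (orth_proj U x) \<bullet> y = orth_proj U x \<bullet> orth_proj U y"
  using assms by (simp add: orth_proj_inner orth_proj_sym[of U x y])

text \<open>
  The composite whose eigenvalues are the squared singular values is \<open>P\<^sub>V P\<^sub>U\<close>: as \<open>P\<^sub>U\<close> is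
  self-adjoint, the adjoint of its restriction to \<open>V\<close> is \<open>P\<^sub>V P\<^sub>U\<close>, and \<open>P\<^sub>U\<close> is idempotent.
\<close>

lemma adjoint_on_orth_proj:
  fixes U V :: "'a::euclidean_space set"
  assumes U: "subspace U" and V: "subspace V"
  shows "adjoint_on V (orth_proj U) (orth_proj U v) = orth_proj V (orth_proj U v)"
  unfolding adjoint_on_def
proof (rule the_equality)
  have key: "orth_proj U x \<bullet> orth_proj U v = x \<bullet> orth_proj V (orth_proj U v)" if "x \<in> V" for x
    using orth_proj_inner[OF V that, of "orth_proj U v"]
      orth_proj_inner[OF U orth_proj_in[OF U], of x v]
    by (simp add: inner_commute)
  then show "orth_proj V (orth_proj U v) \<in> V \<and>
      (\<forall>x\<in>V. orth_proj U x \<bullet> orth_proj U v = x \<bullet> orth_proj V (orth_proj U v))"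
    using orth_proj_in[OF V] by blast
  fix w assume w: "w \<in> V \<and> (\<forall>x\<in>V. orth_proj U x \<bullet> orth_proj U v = x \<bullet> w)"
  then have "w - orth_proj V (orth_proj U v) \<in> V"
    using V by (simp add: orth_proj_in subspace_diff)
  then have "(w - orth_proj V (orth_proj U v)) \<bullet> (w - orth_proj V (orth_proj U v)) = 0"
    using w key by (metis inner_diff_right right_minus_eq)
  then show "w = orth_proj V (orth_proj U v)" by simp
qed

section \<open>Principal angles as eigenvalues\<close>

lemma sorted_concat_replicate:
  fixes ts :: "'a::linorder list"
  assumes "sorted_wrt (>) ts"
  shows "sorted_wrt (\<ge>) (concat (map (\<lambda>t. replicate (m t) t) ts))"
proof -
  have "sorted_wrt (\<ge>) (replicate k t)" for k and t :: 'a
    by (induction k) auto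
  then show ?thesis
    using assms by (induction ts) (fastforce simp: sorted_wrt_append)+
qed

lemma count_list_replicate: "count_list (replicate k t) x = (if t = x then k else 0)"
  by (induction k) auto

lemma count_list_concat_replicate:
  assumes "distinct ts"
  shows "count_list (concat (map (\<lambda>t. replicate (m t) t) ts)) x = (if x \<in> set ts then m x else 0)"
  using assms by (induction ts) (auto simp: count_list_replicate)

text \<open>
  Applied to the singular values with \<open>c = 1\<close>, this shows that the Friedrichs angle comes from the
  largest singular value below 1.
\<close>

lemma decreasing_list_split_max:
  fixes xs :: "'a::linorder list"
  assumes "sorted_wrt (\<ge>) xs" "\<And>x. x \<in> set xs \<Longrightarrow> x \<le> c"
  shows "xs = replicate (count_list xs c) c @ filter (\<lambda>x. x \<noteq> c) xs"
  using assms
proof (induction xs)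
  case (Cons y ys)
  show ?case
  proof (cases "y = c")
    case False
    then have "c \<notin> set (y # ys)"
      using Cons.prems by force
    then have "count_list (y # ys) c = 0" "filter (\<lambda>x. x \<noteq> c) (y # ys) = y # ys"
      by (intro count_notin filter_True; auto)+
    then show ?thesis
      by (simp only: replicate_0 append_Nil)
  qed (use Cons in auto)
qed simp

text \<open>
  On a unit eigenvector \<open>e\<close> of \<open>P\<^sub>V P\<^sub>U\<close> in \<open>V\<close> the eigenvalue is the squared length of \<open>P\<^sub>U e\<close>. It
  lies between 0 and 1 and equals 1 exactly when \<open>e\<close> belongs to \<open>U\<close>. The singular value 1 thus
  has multiplicity \<open>dim (U \<inter> V)\<close>, and it fills the places of the list before the one read by the
  Friedrichs angle. The other eigenvalues lie between the squares of the last singular value and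
  of the first one below 1.
\<close>

lemma principal_angles_eigenbasis:
  fixes U V :: "'a::euclidean_space set"
  assumes U: "subspace U" and V: "subspace V" and "\<not> V \<subseteq> U"
  obtains B l \<sigma>F \<sigma>p where
    "pairwise orthogonal B" "\<And>e. e \<in> B \<Longrightarrow> norm e = 1" "span B = V"
    "\<And>e. e \<in> B \<Longrightarrow> orth_proj V (orth_proj U e) = l e *\<^sub>R e"
    "friedrichs_angle U V = arccos \<sigma>F" "principal_angle U V (dim V) = arccos \<sigma>p"
    "0 \<le> \<sigma>p" "\<sigma>p \<le> \<sigma>F" "\<sigma>F < 1"
    "\<And>e. e \<in> B \<Longrightarrow> e \<notin> U \<Longrightarrow> \<sigma>p\<^sup>2 \<le> l e \<and> l e \<le> \<sigma>F\<^sup>2"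
proof -
  define T where "T = (\<lambda>v. orth_proj V (orth_proj U v))"
  have linT: "linear T"
    unfolding T_def using linear_compose[OF linear_orth_proj[OF U] linear_orth_proj[OF V]]
    by (simp add: o_def)
  have TV: "T x \<in> V" for x
    by (simp add: T_def orth_proj_in V)
  have symT: "T x \<bullet> y = x \<bullet> T y" if "x \<in> V" "y \<in> V" for x y
    using orth_proj_twice_inner[OF U V that(1), of y] orth_proj_twice_inner[OF U V that(2), of x]
    by (simp add: T_def inner_commute)
  have "\<exists>B. pairwise orthogonal B \<and> (\<forall>e\<in>B. norm e = 1 \<and> (\<exists>c. T e = c *\<^sub>R e)) \<and> span B = V"
    by (intro self_adjoint_orthonormal_eigenbasis linT V TV symT)
  then obtain B where B: "pairwise orthogonal B" "\<And>e. e \<in> B \<Longrightarrow> norm e = 1" "span B = V"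
    and ex: "\<And>e. e \<in> B \<Longrightarrow> \<exists>c. T e = c *\<^sub>R e"
    by blast
  obtain l where l: "\<And>e. e \<in> B \<Longrightarrow> T e = l e *\<^sub>R e"
    using ex by metis
  have fin: "finite B" using pairwise_orthogonal_imp_finite[OF B(1)] .
  have ind: "independent B"
    using B(1)
  proof (rule pairwise_orthogonal_independent)
    show "0 \<notin> B" using B(2) by fastforce
  qed
  have BV: "e \<in> V" if "e \<in> B" for e using that B(3) span_base by blast
  have le: "l e = orth_proj U e \<bullet> orth_proj U e" if "e \<in> B" for e
    using orth_proj_twice_inner[OF U V BV[OF that], of e] l[OF that] B(2)[OF that]
    by (simp add: T_def dot_square_norm)
  have l01: "0 \<le> l e" "l e \<le> 1" "l e = 1 \<longleftrightarrow> e \<in> U" if "e \<in> B" for e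
    using orth_proj_norm_le[OF U, of e] orth_proj_norm_eq_iff[OF U, of e] le[OF that] B(2)[OF that]
    by (auto simp: dot_square_norm)

  define m where "m = singular_mult V (orth_proj U)"
  have m_eigenspace: "m t = dim {v \<in> V. T v = t\<^sup>2 *\<^sub>R v}" for t
    by (simp add: m_def singular_mult_def adjoint_on_orth_proj[OF U V] T_def)
  have m_card: "m t = card {e \<in> B. l e = t\<^sup>2}" for t
  proof -
    have "{v \<in> span B. T v = t\<^sup>2 *\<^sub>R v} = span {e \<in> B. l e = t\<^sup>2}"
      by (rule eigenspace_eq_span) (fact linT B l)+
    moreover have "independent {e \<in> B. l e = t\<^sup>2}"
      using ind by (rule independent_mono) auto
    ultimately show ?thesis
      unfolding m_eigenspace B(3)[symmetric] by (simp add: dim_span_eq_card_independent del: dim_span)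
  qed
  have m_1: "m 1 = dim (U \<inter> V)"
  proof -
    have "v \<in> U" if "v \<in> V" "T v = v" for v
      using that orth_proj_twice_inner[OF U V that(1), of v] orth_proj_norm_eq_iff[OF U, of v]
      by (simp add: T_def)
    moreover have "T v = v" if "v \<in> U" "v \<in> V" for v
      unfolding T_def orth_proj_self[OF U that(1)] by (rule orth_proj_self[OF V that(2)])
    ultimately have "{v \<in> V. T v = v} = U \<inter> V"
      by blast
    then show ?thesis by (simp add: m_eigenspace)
  qed
  define S where "S = {t. 0 \<le> t \<and> 0 < m t}"
  have S: "S = (\<lambda>e. sqrt (l e)) ` B"
  proof -
    have "t \<in> S \<longleftrightarrow> t \<in> (\<lambda>e. sqrt (l e)) ` B" for t
    proof -
      have "t \<in> S \<longleftrightarrow> 0 \<le> t \<and> (\<exists>e\<in>B. l e = t\<^sup>2)"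
        using fin by (auto simp: S_def m_card card_gt_0_iff)
      also have "\<dots> \<longleftrightarrow> (\<exists>e\<in>B. t = sqrt (l e))"
      proof -
        have "0 \<le> t \<and> l e = t\<^sup>2 \<longleftrightarrow> t = sqrt (l e)" if "e \<in> B" for e
          using l01(1)[OF that] by auto
        then show ?thesis by blast
      qed
      finally show ?thesis by blast
    qed
    then show ?thesis by blast
  qed
  have S_le: "0 \<le> t" "t \<le> 1" if "t \<in> S" for t
    using that l01 by (auto simp: S)
  have finS: "finite S" using fin by (simp add: S)
  have sum_m: "sum m S = dim V"
  proof -
    have "dim V = card B"
      using dim_span_eq_card_independent[OF ind] B(3) by simp
    also have "\<dots> = (\<Sum>t\<in>S. card {e \<in> B. sqrt (l e) = t})"
      unfolding S card_eq_sum by (rule sum.image_gen[OF fin])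
    also have "\<dots> = sum m S"
      by (intro sum.cong refl, unfold m_card, rule arg_cong[where f = card])
        (use l01(1) S_le(1) in auto)
    finally show ?thesis by simp
  qed

  define L where "L = singular_values V (orth_proj U)"
  have L: "L = concat (map (\<lambda>t. replicate (m t) t) (rev (sorted_list_of_set S)))"
    by (simp add: L_def singular_values_def m_def S_def)
  have setL: "set L = S"
    using finS by (auto simp: L S_def)
  have lenL: "length L = dim V"
    by (simp add: L length_concat comp_def rev_map[symmetric] sum_list_rev
        sum_list_distinct_conv_sum_set finS sum_m)
  have sortedL: "sorted_wrt (\<ge>) L"
    unfolding L by (intro sorted_concat_replicate) (simp add: sorted_wrt_rev)
  have countL: "count_list L 1 = dim (U \<inter> V)"
    using finS by (auto simp: L count_list_concat_replicate m_1 S_def)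
  define F where "F = filter (\<lambda>x. x \<noteq> 1) L"
  have split: "L = replicate (dim (U \<inter> V)) 1 @ F"
    using decreasing_list_split_max[OF sortedL, of 1] S_le by (simp add: setL countL F_def)
  have "dim (U \<inter> V) < dim V"
    using U V assms(3) by (intro dim_psubset) (auto simp: span_eq_iff[THEN iffD2] subspace_inter)
  then have "F \<noteq> []"
    using split lenL by (metis append_Nil2 length_replicate less_irrefl)
  then obtain \<sigma>F F' where F: "F = \<sigma>F # F'" by (cases F) auto
  have "sorted_wrt (\<ge>) F"
    using sortedL unfolding F_def by (rule sorted_wrt_filter)
  then have F_le: "x \<le> \<sigma>F" if "x \<in> set F" for x
    using that by (auto simp: F)
  \<comment> \<open>The list is indexed from 0 while angles are numbered from 1, so the Friedrichs angle reads the
      first entry after the \<open>dim (U \<inter> V)\<close> ones.\<close>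
  have LF: "L ! dim (U \<inter> V) = \<sigma>F"
    by (subst split) (simp add: F nth_append)
  have \<sigma>F: "\<sigma>F \<in> S" "\<sigma>F \<noteq> 1"
    using F by (auto simp: setL[symmetric] F_def dest: filter_eq_ConsD)
  have Lne: "L \<noteq> []" using split F by simp
  define \<sigma>p where "\<sigma>p = last L"
  have Lp: "L ! (dim V - 1) = \<sigma>p"
    using last_conv_nth[OF Lne] by (simp add: \<sigma>p_def lenL)
  have L_ge: "\<sigma>p \<le> x" if "x \<in> set L" for x
  proof -
    have L_snoc: "L = butlast L @ [\<sigma>p]"
      using Lne by (simp add: \<sigma>p_def)
    have "sorted_wrt (\<ge>) (butlast L @ [\<sigma>p])"
      using sortedL by (simp only: L_snoc[symmetric])
    moreover have "x \<in> set (butlast L @ [\<sigma>p])"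
      using that by (simp only: L_snoc[symmetric])
    ultimately show ?thesis
      by (auto simp: sorted_wrt_append)
  qed
  show ?thesis
  proof (rule that[of B l \<sigma>F \<sigma>p])
    show "pairwise orthogonal B" "span B = V" by (fact B)+
    show "norm e = 1" "orth_proj V (orth_proj U e) = l e *\<^sub>R e" if "e \<in> B" for e
      using B(2)[OF that] l[OF that] by (simp_all add: T_def)
    show "friedrichs_angle U V = arccos \<sigma>F" "principal_angle U V (dim V) = arccos \<sigma>p"
      using LF Lp by (simp_all add: friedrichs_angle_def principal_angle_def L_def)
    show "0 \<le> \<sigma>p" "\<sigma>p \<le> \<sigma>F" "\<sigma>F < 1"
      using S_le \<sigma>F L_ge Lne by (auto simp: setL[symmetric] \<sigma>p_def less_le)
    show "\<sigma>p\<^sup>2 \<le> l e \<and> l e \<le> \<sigma>F\<^sup>2" if e: "e \<in> B" "e \<notin> U" for e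
    proof -
      have "sqrt (l e) \<in> set L" using e by (auto simp: setL S)
      moreover from this have "sqrt (l e) \<in> set F" using l01(3) e by (auto simp: F_def)
      ultimately have "\<sigma>p \<le> sqrt (l e)" "sqrt (l e) \<le> \<sigma>F" using L_ge F_le by auto
      then show ?thesis
        using l01(1)[OF e(1)] \<open>0 \<le> \<sigma>p\<close>
        by (metis power_mono real_sqrt_ge_zero real_sqrt_pow2)
    qed
  qed
qed

section \<open>Chebyshev polynomials and the semi-iteration\<close>

fun cheb_T :: "nat \<Rightarrow> real \<Rightarrow> real" where
  "cheb_T 0 x = 1"
| "cheb_T (Suc 0) x = x"
| "cheb_T (Suc (Suc k)) x = 2 * x * cheb_T (Suc k) x - cheb_T k x"

lemma cheb_T_cos: "cheb_T k (cos t) = cos (real k * t)"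
proof (induction k "cos t" rule: cheb_T.induct)
  case (3 k)
  define s where "s = real (Suc k) * t"
  have "real (Suc (Suc k)) * t = s + t" "real k * t = s - t"
    by (simp_all add: s_def algebra_simps)
  then have "cos (real (Suc (Suc k)) * t) = 2 * cos t * cos s - cos (real k * t)"
    by (simp add: cos_add cos_diff)
  with 3 show ?case by (simp only: cheb_T.simps s_def)
qed auto

lemma abs_cheb_T_le_1:
  assumes "\<bar>x\<bar> \<le> 1"
  shows "\<bar>cheb_T k x\<bar> \<le> 1"
  using cheb_T_cos[of k "arccos x"] assms by (simp add: cos_arccos_abs)

text \<open>Outside \<open>[-1, 1]\<close>, the substitution \<open>(q + 1/q) / 2\<close> replaces the cosine.\<close>

lemma cheb_T_Joukowski:
  assumes "q \<noteq> 0"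
  shows "cheb_T k ((q + 1 / q) / 2) = (q ^ k + 1 / q ^ k) / 2"
proof (induction k "(q + 1 / q) / 2" rule: cheb_T.induct)
  case (3 k)
  show ?case
    unfolding cheb_T.simps 3 using assms by (simp add: field_simps)
qed simp_all

lemma cheb_T_ge_1:
  assumes "1 \<le> r"
  shows "1 \<le> cheb_T k r"
proof -
  have "1 \<le> cheb_T k r \<and> cheb_T k r \<le> cheb_T (Suc k) r"
  proof (induction k)
    case (Suc k)
    then have "1 * cheb_T (Suc k) r \<le> r * cheb_T (Suc k) r"
      using assms by (intro mult_right_mono) auto
    with Suc have "cheb_T (Suc k) r \<le> cheb_T (Suc (Suc k)) r"
      unfolding cheb_T.simps by linarith
    with Suc show ?case by simp
  qed (use assms in simp)
  then show ?thesis ..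
qed

text \<open>
  Dividing the three-term recurrence at \<open>r\<close> by \<open>2 r T\<^sub>k\<^sub>+\<^sub>1(r)\<close> gives the recursion for the
  reciprocal weights.
\<close>

lemma cheb_omega_eq:
  assumes "1 < r"
  shows "cheb_omega r (Suc (Suc k)) = 2 * r * cheb_T (Suc k) r / cheb_T (Suc (Suc k)) r"
proof (induction k)
  case (Suc k)
  have pos: "0 < cheb_T j r" for j
    using cheb_T_ge_1[of r j] assms by linarith
  let ?T = "\<lambda>j. cheb_T (Suc j) r"
  have step: "?T (Suc (Suc k)) = 2 * r * ?T (Suc k) - ?T k" by simp
  have "4 * r\<^sup>2 - 2 * r * ?T k / ?T (Suc k) = 2 * r * ?T (Suc (Suc k)) / ?T (Suc k)"
    unfolding step using pos[of "Suc (Suc k)"] by (simp add: field_simps power2_eq_square del: cheb_T.simps)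
  moreover have "4 * r\<^sup>2 / (2 * r * ?T (Suc (Suc k)) / ?T (Suc k))
      = 2 * r * ?T (Suc k) / ?T (Suc (Suc k))"
    using pos[of "Suc (Suc k)"] pos[of "Suc (Suc (Suc k))"] assms
    by (simp add: field_simps power2_eq_square del: cheb_T.simps)
  ultimately show ?case
    using Suc.IH by (simp del: cheb_T.simps)
qed (simp add: power2_eq_square mult.assoc)

lemma cheb_iter_in_subspace:
  fixes M :: "'a::euclidean_space \<Rightarrow> 'a"
  assumes V: "subspace V" and MV: "\<And>w. w \<in> V \<Longrightarrow> M w \<in> V" and w0: "w0 \<in> V"
  shows "cheb_iter M a b w0 k \<in> V"
proof -
  have step: "v - c *\<^sub>R M v \<in> V" if "v \<in> V" for c v
    using that MV V by (simp add: subspace_diff subspace_scale)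
  have "cheb_iter M a b w0 k \<in> V \<and> cheb_iter M a b w0 (Suc k) \<in> V"
  proof (induction k)
    case (Suc k)
    then show ?case
      by (simp only: cheb_iter.simps Let_def) (intro conjI subspace_add subspace_scale V step; simp)
  qed (simp add: w0 step Let_def)
  then show ?thesis ..
qed

text \<open>
  The iterate \<open>w\<^sub>k\<close> is a polynomial in \<open>M\<close> applied to \<open>w\<^sub>0\<close>, namely the Chebyshev polynomial
  transported affinely from \<open>[a, b]\<close> to \<open>[-1, 1]\<close> and normalised to be 1 at 0. It is recorded here
  coordinatewise, and with the normalising factor multiplied out. With \<open>d\<close> the midpoint
  of \<open>[a, b]\<close>, and \<open>r\<close> and \<open>x\<close> the two arguments of \<open>cheb_T\<close> below, \<open>1 - \<mu> / d = x / r\<close>;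
  multiplying a step of the semi-iteration by the Chebyshev value at \<open>r\<close> therefore turns it into
  the three-term recurrence at \<open>x\<close>.
\<close>

lemma cheb_iter_eigencomponent:
  fixes M :: "'a::euclidean_space \<Rightarrow> 'a"
  assumes V: "subspace V" and MV: "\<And>w. w \<in> V \<Longrightarrow> M w \<in> V"
    and eig: "\<And>w. w \<in> V \<Longrightarrow> M w \<bullet> e = \<mu> * (w \<bullet> e)"
    and w0: "w0 \<in> V" and ab: "0 < a" "a < b"
  shows "cheb_T k ((a + b) / (b - a)) * (cheb_iter M a b w0 k \<bullet> e)
      = cheb_T k ((a + b - 2 * \<mu>) / (b - a)) * (w0 \<bullet> e)"
proof -
  define r where "r = (a + b) / (b - a)"
  define x where "x = (a + b - 2 * \<mu>) / (b - a)"
  define d where "d = (a + b) / 2"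
  define w where "w = cheb_iter M a b w0"
  have r: "1 < r" using ab by (simp add: r_def)
  have d: "d \<noteq> 0" using ab by (simp add: d_def)
  have "1 - \<mu> / d = (a + b - 2 * \<mu>) / (a + b)"
    using ab by (simp add: d_def diff_divide_distrib)
  then have rx: "r * (1 - \<mu> / d) = x"
    using ab by (simp add: r_def x_def)
  have w_0: "w 0 = w0" and w_1: "w (Suc 0) = w0 - inverse d *\<^sub>R M w0"
    by (simp_all add: w_def d_def)
  have w_step: "w (Suc (Suc k)) = cheb_omega r (Suc (Suc k)) *\<^sub>R
        (w (Suc k) - inverse d *\<^sub>R M (w (Suc k))) + (1 - cheb_omega r (Suc (Suc k))) *\<^sub>R w k" for k
    unfolding w_def cheb_iter.simps Let_def d_def r_def ..
  have rel: "(v - inverse d *\<^sub>R M v) \<bullet> e = (1 - \<mu> / d) * (v \<bullet> e)" if "v \<in> V" for v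
    using eig[OF that] by (simp add: inner_simps field_simps)
  have inV: "w k \<in> V" for k
    unfolding w_def by (rule cheb_iter_in_subspace[OF V MV w0])
  define P where "P k \<longleftrightarrow> cheb_T k r * (w k \<bullet> e) = cheb_T k x * (w0 \<bullet> e)" for k
  have "P k \<and> P (Suc k)"
  proof (induction k)
    case 0
    show ?case
      using rel[OF w0] rx unfolding P_def w_0 w_1
      by (simp add: mult.assoc[symmetric])
  next
    case (Suc k)
    define t where "t = cheb_T (Suc (Suc k)) r"
    define \<omega> where "\<omega> = cheb_omega r (Suc (Suc k))"
    have "0 < t" using cheb_T_ge_1[of r "Suc (Suc k)"] r unfolding t_def by linarith
    then have t\<omega>: "t * \<omega> = 2 * r * cheb_T (Suc k) r"
      using cheb_omega_eq[OF r, of k] by (simp add: \<omega>_def t_def del: cheb_T.simps cheb_omega.simps)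
    have IH: "cheb_T k r * (w k \<bullet> e) = cheb_T k x * (w0 \<bullet> e)"
      "cheb_T (Suc k) r * (w (Suc k) \<bullet> e) = cheb_T (Suc k) x * (w0 \<bullet> e)"
      using Suc.IH by (simp_all only: P_def)
    have "t * (w (Suc (Suc k)) \<bullet> e)
        = (t * \<omega>) * ((1 - \<mu> / d) * (w (Suc k) \<bullet> e)) + (t - t * \<omega>) * (w k \<bullet> e)"
      unfolding w_step \<omega>_def[symmetric] inner_add_left inner_scaleR_left rel[OF inV]
      by (simp add: algebra_simps)
    also have "\<dots> = 2 * (r * (1 - \<mu> / d)) * (cheb_T (Suc k) r * (w (Suc k) \<bullet> e))
        - cheb_T k r * (w k \<bullet> e)"
      unfolding t\<omega> by (simp add: t_def algebra_simps)
    also have "\<dots> = cheb_T (Suc (Suc k)) x * (w0 \<bullet> e)"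
      unfolding rx IH by (simp add: algebra_simps)
    finally show ?case
      using Suc.IH by (simp add: P_def t_def del: cheb_T.simps)
  qed
  then show ?thesis by (simp add: P_def w_def r_def x_def)
qed

section \<open>The two rates\<close>

lemma rho_Cheb_pos: "0 < a \<Longrightarrow> a < b \<Longrightarrow> 0 < rho_Cheb a b"
  unfolding rho_Cheb_def by (intro divide_pos_pos add_pos_pos) auto

text \<open>Through this identity powers of the rate give the Chebyshev values that normalise the iterates.\<close>

lemma rho_Cheb_Joukowski:
  assumes "0 < a" "a < b"
  shows "(a + b) / (b - a) = (rho_Cheb a b + 1 / rho_Cheb a b) / 2"
proof -
  obtain p q where pq: "a = p\<^sup>2" "b = q\<^sup>2" "0 < p" "p < q"
    using assms by (metis less_trans real_sqrt_gt_0_iff real_sqrt_less_iff real_sqrt_pow2 less_imp_le)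
  then show ?thesis
    by (simp add: rho_Cheb_def divide_simps) (auto simp: algebra_simps power2_eq_square)
qed

lemma rho_V_div_rho_Cheb:
  assumes "0 < a" "a < b"
  shows "rho_V a b / rho_Cheb a b = (sqrt a + sqrt b)\<^sup>2 / (a + b)"
proof -
  obtain p q where pq: "a = p\<^sup>2" "b = q\<^sup>2" "0 < p" "p < q"
    using assms by (metis less_trans real_sqrt_gt_0_iff real_sqrt_less_iff real_sqrt_pow2 less_imp_le)
  then show ?thesis
    by (simp add: rho_Cheb_def rho_V_def divide_simps) (auto simp: algebra_simps power2_eq_square)
qed

lemma ratio_expand:
  assumes "0 < a" "0 < (b::real)"
  shows "(sqrt a + sqrt b)\<^sup>2 / (a + b) = 1 + 2 * sqrt (a * b) / (a + b)"
  using assms by (simp add: field_simps power2_sum real_sqrt_mult)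

text \<open>
  With \<open>q = rho_Cheb a b\<close> the left side is \<open>2 / (q\<^sup>k + q\<^sup>-\<^sup>k)\<close>; the bound drops \<open>q\<^sup>k\<close>.
\<close>

lemma inverse_cheb_T_le:
  assumes "0 < a" "a < b"
  shows "1 / cheb_T k ((a + b) / (b - a)) \<le> 2 * rho_Cheb a b ^ k"
proof -
  define q where "q = rho_Cheb a b"
  have q: "0 < q" unfolding q_def using assms by (rule rho_Cheb_pos)
  have "1 / ((q ^ k + 1 / q ^ k) / 2) \<le> 1 / ((1 / q ^ k) / 2)"
    using q by (intro divide_left_mono divide_right_mono mult_pos_pos divide_pos_pos add_pos_pos) auto
  then show ?thesis
    using q by (simp add: rho_Cheb_Joukowski[OF assms] q_def[symmetric] cheb_T_Joukowski)
qed

text \<open>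
  Both rates are homogeneous of degree 0, so their limits reduce to limits in the single variable
  \<open>a / b\<close>.
\<close>

lemma tendsto_ratio_to_one:
  assumes "(f \<longlongrightarrow> c) (at_left 1)" "\<And>a b. 0 < a \<Longrightarrow> a < b \<Longrightarrow> g a b = f (a / b)"
  shows "((\<lambda>(a, b). g a b) \<longlongrightarrow> c) ratio_to_one"
proof -
  have "((\<lambda>z. f ((\<lambda>(a, b). a / b) z)) \<longlongrightarrow> c) ratio_to_one"
    unfolding ratio_to_one_def
    by (rule filterlim_mono[OF filterlim_filtercomapI[OF assms(1)] order_refl inf_le1])
  moreover have "\<forall>\<^sub>F z in ratio_to_one. f ((\<lambda>(a, b). a / b) z) = (\<lambda>(a, b). g a b) z"
    unfolding ratio_to_one_def eventually_inf_principal
    by (intro always_eventually) (auto simp: assms(2))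
  ultimately show ?thesis by (rule Lim_transform_eventually)
qed

lemma
  shows tendsto_rho_V: "((\<lambda>(a, b). rho_V a b) \<longlongrightarrow> 0) ratio_to_one"
    and tendsto_rho_Cheb: "((\<lambda>(a, b). rho_Cheb a b) \<longlongrightarrow> 0) ratio_to_one"
    and tendsto_rho_ratio: "((\<lambda>(a, b). rho_V a b / rho_Cheb a b) \<longlongrightarrow> 2) ratio_to_one"
proof -
  have "((\<lambda>x::real. (1 - x) / (1 + x)) \<longlongrightarrow> 0) (at_left 1)"
    by (auto intro!: tendsto_eq_intros)
  then show "((\<lambda>(a, b). rho_V a b) \<longlongrightarrow> 0) ratio_to_one"
  proof (rule tendsto_ratio_to_one)
    fix a b :: real assume ab: "0 < a" "a < b"
    then have "1 - a / b = (b - a) / b" "1 + a / b = (b + a) / b"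
      by (simp_all add: diff_divide_distrib add_divide_distrib)
    then show "rho_V a b = (1 - a / b) / (1 + a / b)"
      using ab by (simp add: rho_V_def)
  qed
  have "((\<lambda>x. (1 - sqrt x) / (1 + sqrt x)) \<longlongrightarrow> 0) (at_left 1)"
    by (auto intro!: tendsto_eq_intros)
  then show "((\<lambda>(a, b). rho_Cheb a b) \<longlongrightarrow> 0) ratio_to_one"
  proof (rule tendsto_ratio_to_one)
    fix a b :: real assume ab: "0 < a" "a < b"
    then have "1 - sqrt (a / b) = (sqrt b - sqrt a) / sqrt b"
        "1 + sqrt (a / b) = (sqrt b + sqrt a) / sqrt b"
      by (simp_all add: real_sqrt_divide diff_divide_distrib add_divide_distrib)
    then show "rho_Cheb a b = (1 - sqrt (a / b)) / (1 + sqrt (a / b))"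
      using ab by (simp add: rho_Cheb_def)
  qed
  have "((\<lambda>x. (sqrt x + 1)\<^sup>2 / (x + 1)) \<longlongrightarrow> 2) (at_left 1)"
    by (auto intro!: tendsto_eq_intros)
  then show "((\<lambda>(a, b). rho_V a b / rho_Cheb a b) \<longlongrightarrow> 2) ratio_to_one"
  proof (rule tendsto_ratio_to_one)
    fix a b :: real assume ab: "0 < a" "a < b"
    have "sqrt (a / b) + 1 = (sqrt a + sqrt b) / sqrt b" "a / b + 1 = (a + b) / b"
      using ab by (simp_all add: real_sqrt_divide add_divide_distrib)
    then have "(sqrt (a / b) + 1)\<^sup>2 / (a / b + 1) = (sqrt a + sqrt b)\<^sup>2 / (a + b)"
      using ab by (simp add: power_divide)
    then show "rho_V a b / rho_Cheb a b = (sqrt (a / b) + 1)\<^sup>2 / (a / b + 1)"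
      using rho_V_div_rho_Cheb[OF ab] by simp
  qed
qed

section \<open>The convergence bound and the comparison of the rates\<close>

text \<open>
  Each coordinate of \<open>w\<^sub>k\<close> in the eigenbasis is at most \<open>2 rho_Cheb\<^sup>k\<close> times that of \<open>w\<^sub>0\<close>, and the
  norms compare by Pythagoras. Basis vectors in \<open>U\<close> are the only ones whose eigenvalue \<open>1 - l e\<close>
  of \<open>M\<close> may leave \<open>[a, b]\<close>, and there \<open>w\<^sub>0\<close> has coordinate 0 because it is orthogonal to
  \<open>U \<inter> V\<close>.
\<close>

lemma cheb_iter_norm_le:
  fixes U V :: "'a::euclidean_space set"
  assumes U: "subspace U" and V: "subspace V"
    and B: "pairwise orthogonal B" "\<And>e. e \<in> B \<Longrightarrow> norm e = 1" "span B = V"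
    and eig: "\<And>e. e \<in> B \<Longrightarrow> orth_proj V (orth_proj U e) = l e *\<^sub>R e"
    and ab: "0 < a" "a < b"
    and bounds: "\<And>e. e \<in> B \<Longrightarrow> e \<notin> U \<Longrightarrow> a \<le> 1 - l e \<and> 1 - l e \<le> b"
    and w0: "w0 \<in> V \<inter> (U \<inter> V)\<^sup>\<bottom>"
  shows "norm (cheb_iter (M_op U V) a b w0 k) \<le> 2 * rho_Cheb a b ^ k * norm w0"
proof -
  define w where "w = cheb_iter (M_op U V) a b w0 k"
  define c where "c = 2 * rho_Cheb a b ^ k"
  define R where "R = cheb_T k ((a + b) / (b - a))"
  have c: "0 \<le> c" using rho_Cheb_pos[OF ab] by (simp add: c_def)
  have R: "1 \<le> R" unfolding R_def using ab by (intro cheb_T_ge_1) (simp add: field_simps)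
  have BV: "e \<in> V" if "e \<in> B" for e using that B(3) span_base by blast
  have MV: "M_op U V v \<in> V" if "v \<in> V" for v
    using that V by (simp add: M_op_def orth_proj_in subspace_diff)
  have comp: "R * (w \<bullet> e) = cheb_T k ((a + b - 2 * (1 - l e)) / (b - a)) * (w0 \<bullet> e)"
    if e: "e \<in> B" for e
    unfolding w_def R_def
  proof (rule cheb_iter_eigencomponent[OF V MV _ _ ab])
    fix v assume v: "v \<in> V"
    have "orth_proj V (orth_proj U v) \<bullet> e = orth_proj V (orth_proj U e) \<bullet> v"
      using orth_proj_twice_inner[OF U V BV[OF e], of v] orth_proj_twice_inner[OF U V v, of e]
      by (simp only: inner_commute)
    then show "M_op U V v \<bullet> e = (1 - l e) * (v \<bullet> e)"
      by (simp add: M_op_def eig[OF e] inner_simps inner_commute algebra_simps)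
  qed (use w0 in auto)
  have wV: "w \<in> V"
    unfolding w_def using w0 by (intro cheb_iter_in_subspace[OF V MV]) auto
  have coord: "\<bar>w \<bullet> e\<bar> \<le> c * \<bar>w0 \<bullet> e\<bar>" if e: "e \<in> B" for e
  proof (cases "e \<in> U")
    case True
    then have "w0 \<bullet> e = 0"
      using w0 BV[OF e] by (auto simp: orthogonal_comp_def orthogonal_def inner_commute)
    then show ?thesis using comp[OF e] R by auto
  next
    case False
    have "\<bar>a + b - 2 * (1 - l e)\<bar> \<le> b - a"
      using bounds[OF e False] by (intro abs_leI) auto
    then have "\<bar>(a + b - 2 * (1 - l e)) / (b - a)\<bar> \<le> 1"
      using ab by (simp add: abs_divide)
    then have "\<bar>R * (w \<bullet> e)\<bar> \<le> 1 * \<bar>w0 \<bullet> e\<bar>"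
      unfolding comp[OF e] abs_mult
      by (intro mult_right_mono abs_cheb_T_le_1) auto
    then have "\<bar>w \<bullet> e\<bar> \<le> 1 / R * \<bar>w0 \<bullet> e\<bar>"
      using R by (simp add: abs_mult field_simps)
    also have "\<dots> \<le> c * \<bar>w0 \<bullet> e\<bar>"
      using inverse_cheb_T_le[OF ab, of k] by (intro mult_right_mono) (auto simp: R_def c_def)
    finally show ?thesis .
  qed
  have "(norm w)\<^sup>2 = (\<Sum>e\<in>B. (w \<bullet> e)\<^sup>2)"
    using wV B by (intro norm_orthonormal_expansion) auto
  also have "\<dots> \<le> (\<Sum>e\<in>B. c\<^sup>2 * (w0 \<bullet> e)\<^sup>2)"
  proof (rule sum_mono)
    fix e assume "e \<in> B"
    show "(w \<bullet> e)\<^sup>2 \<le> c\<^sup>2 * (w0 \<bullet> e)\<^sup>2"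
      using power_mono[OF coord[OF \<open>e \<in> B\<close>], of 2] by (simp add: power_mult_distrib)
  qed
  also have "\<dots> = (c * norm w0)\<^sup>2"
    using norm_orthonormal_expansion[OF B(1,2), of w0] w0 B(3)
    by (simp add: power_mult_distrib sum_distrib_left)
  finally have "norm w \<le> c * norm w0"
    by (rule power2_le_imp_le) (simp add: c)
  then show ?thesis by (simp add: w_def c_def)
qed

theorem theorem6p9:
  fixes U V :: "(real ^ 'n) set" and a b :: real
  assumes "subspace U" and "subspace V" and "\<not> V \<subseteq> U"
    and "a = (sin (friedrichs_angle U V))\<^sup>2"
    and "b = (sin (principal_angle U V (dim V)))\<^sup>2"
  shows "(friedrichs_angle U V < principal_angle U V (dim V) \<longleftrightarrow> a < b)
    \<and> (friedrichs_angle U V < principal_angle U V (dim V) \<longrightarrow>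
          rho_Cheb a b < rho_V a b
        \<and> rho_V a b / rho_Cheb a b = (sqrt a + sqrt b)\<^sup>2 / (a + b)
        \<and> (sqrt a + sqrt b)\<^sup>2 / (a + b) = 1 + 2 * sqrt (a * b) / (a + b)
        \<and> rho_V a b / rho_Cheb a b \<in> {1<..2}
        \<and> (\<forall>w0 \<in> V \<inter> (U \<inter> V)\<^sup>\<bottom>. \<forall>k.
              norm (cheb_iter (M_op U V) a b w0 k) \<le> 2 * rho_Cheb a b ^ k * norm w0)
        \<and> rho_Cheb a b \<le> rho_V a b * inverse (1 + 2 * sqrt (a * b) / (a + b)))
    \<and> ((\<lambda>(a', b'). rho_V a' b' / rho_Cheb a' b') \<longlongrightarrow> 2) ratio_to_one
    \<and> ((\<lambda>(a', b'). rho_V a' b') \<longlongrightarrow> 0) ratio_to_one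
    \<and> ((\<lambda>(a', b'). rho_Cheb a' b') \<longlongrightarrow> 0) ratio_to_one"
proof (rule principal_angles_eigenbasis[OF assms(1-3)])
  fix B :: "(real ^ 'n) set" and l and \<sigma>F \<sigma>p :: real
  assume B: "pairwise orthogonal B" "\<And>e. e \<in> B \<Longrightarrow> norm e = 1" "span B = V"
    and eig: "\<And>e. e \<in> B \<Longrightarrow> orth_proj V (orth_proj U e) = l e *\<^sub>R e"
    and \<theta>: "friedrichs_angle U V = arccos \<sigma>F" "principal_angle U V (dim V) = arccos \<sigma>p"
    and \<sigma>: "0 \<le> \<sigma>p" "\<sigma>p \<le> \<sigma>F" "\<sigma>F < 1"
    and l: "\<And>e. e \<in> B \<Longrightarrow> e \<notin> U \<Longrightarrow> \<sigma>p\<^sup>2 \<le> l e \<and> l e \<le> \<sigma>F\<^sup>2"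
  have sq: "\<sigma>F\<^sup>2 < 1" "\<sigma>p\<^sup>2 \<le> 1"
    using \<sigma> by (auto simp: power_less_one_iff power_le_one)
  have a: "a = 1 - \<sigma>F\<^sup>2" and b: "b = 1 - \<sigma>p\<^sup>2"
    using \<sigma> unfolding assms(4,5) \<theta> sin_squared_eq by simp_all
  have iff: "friedrichs_angle U V < principal_angle U V (dim V) \<longleftrightarrow> a < b"
  proof -
    have "\<sigma>p < \<sigma>F \<longleftrightarrow> \<sigma>p\<^sup>2 < \<sigma>F\<^sup>2"
      using \<sigma> by (meson not_le order_trans power_mono_iff zero_less_numeral)
    then show ?thesis
      using \<sigma> unfolding \<theta> a b by (simp add: arccos_less_mono abs_le_iff)
  qed
  have "rho_Cheb a b < rho_V a b
        \<and> rho_V a b / rho_Cheb a b = (sqrt a + sqrt b)\<^sup>2 / (a + b)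
        \<and> (sqrt a + sqrt b)\<^sup>2 / (a + b) = 1 + 2 * sqrt (a * b) / (a + b)
        \<and> rho_V a b / rho_Cheb a b \<in> {1<..2}
        \<and> (\<forall>w0 \<in> V \<inter> (U \<inter> V)\<^sup>\<bottom>. \<forall>k.
              norm (cheb_iter (M_op U V) a b w0 k) \<le> 2 * rho_Cheb a b ^ k * norm w0)
        \<and> rho_Cheb a b \<le> rho_V a b * inverse (1 + 2 * sqrt (a * b) / (a + b))" if "a < b"
  proof -
    have ab: "0 < a" "a < b" using that sq(1) a by linarith+
    define g where "g = 2 * sqrt (a * b) / (a + b)"
    have g: "0 < g" "g \<le> 1"
      using ab arith_geo_mean_sqrt[of a b] by (auto simp: g_def)
    have ratio: "rho_V a b / rho_Cheb a b = 1 + g"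
      using rho_V_div_rho_Cheb[OF ab] ratio_expand[of a b] ab by (simp add: g_def)
    have pos: "0 < rho_Cheb a b" by (rule rho_Cheb_pos[OF ab])
    have V: "rho_V a b = rho_Cheb a b * (1 + g)"
      using ratio pos by (simp add: field_simps)
    have "norm (cheb_iter (M_op U V) a b w0 k) \<le> 2 * rho_Cheb a b ^ k * norm w0"
      if "w0 \<in> V \<inter> (U \<inter> V)\<^sup>\<bottom>" for w0 k
      using l that by (intro cheb_iter_norm_le[OF assms(1,2) B eig ab]) (auto simp: a b)
    moreover have "rho_Cheb a b < rho_V a b"
      using pos g by (simp add: V)
    moreover have "rho_Cheb a b \<le> rho_V a b * inverse (1 + g)"
      using g by (simp add: V mult.assoc)
    ultimately show ?thesis
      using rho_V_div_rho_Cheb[OF ab] ratio_expand[of a b] ab ratio g by (simp add: g_def)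
  qed
  with iff show ?thesis
    using tendsto_rho_V tendsto_rho_Cheb tendsto_rho_ratio by blast
qed

end
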